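(* Let $n,\sigma\in\mathbb{N}$ be positive integers, $\tau\in\mathbb{Z}$, $\Delta>0$, $\alpha_1,\dots,\alpha_n\in\mathbb{C}$, and $\phi_1,\dots,\phi_n\in\mathbb{R}$ with $|\phi_i|\Delta<\pi$ for all $i$. For $s\in\mathbb{Z}$ put $f_s=\sum_{i=1}^n\alpha_i\cos(\phi_i s\Delta)$. Then the $n\times n$ matrix ${}^{\tau}_{\sigma}C_n$ built from these samples (defined in the context) factorizes as $${}^{\tau}_{\sigma}C_n = W_n L_n A_n W_n^T,$$ where $W_n=\big(\cos(\phi_i k\sigma\Delta)\big)_{k=0,\dots,n-1;\ i=1,\dots,n}$ (row index $k$, column index $i$, so the first row consists of ones), $A_n=\mathrm{diag}(\alpha_1,\dots,\alpha_n)$ and $L_n=\mathrm{diag}(\cos(\phi_1\tau\Delta),\dots,\cos(\phi_n\tau\Delta))$.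
   Context: For a family $(f_s)_{s\in\mathbb{Z}}$ of complex numbers, $n\ge 1$, and $\sigma,\tau\in\mathbb{Z}$, the Hankel matrix ${}^{\tau}_{\sigma}H_n$ is the $n\times n$ matrix with entry $f_{\tau+(k+\ell)\sigma}$ at position $(k+1,\ell+1)$, and the Toeplitz matrix ${}^{\tau}_{\sigma}T_n$ is the $n\times n$ matrix with entry $f_{\tau+(k-\ell)\sigma}$ at position $(k+1,\ell+1)$, for $k,\ell=0,\dots,n-1$. Then $${}^{\tau}_{\sigma}C_n := \tfrac14\,{}^{\tau}_{\sigma}H_n+\tfrac14\,{}^{\tau}_{-\sigma}H_n+\tfrac14\,{}^{\tau}_{\sigma}T_n+\tfrac14\,{}^{\tau}_{-\sigma}T_n .$$ *)

theory Defs
  imports Complex_Main "Jordan_Normal_Form.Matrix"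
begin

definition hankel_mat :: "(int \<Rightarrow> complex) \<Rightarrow> int \<Rightarrow> int \<Rightarrow> nat \<Rightarrow> complex mat" where
  "hankel_mat f \<tau> \<sigma> n = mat n n (\<lambda>(k, l). f (\<tau> + (int k + int l) * \<sigma>))"

definition toeplitz_mat :: "(int \<Rightarrow> complex) \<Rightarrow> int \<Rightarrow> int \<Rightarrow> nat \<Rightarrow> complex mat" where
  "toeplitz_mat f \<tau> \<sigma> n = mat n n (\<lambda>(k, l). f (\<tau> + (int k - int l) * \<sigma>))"

definition cosine_mat :: "(int \<Rightarrow> complex) \<Rightarrow> int \<Rightarrow> int \<Rightarrow> nat \<Rightarrow> complex mat" where
  "cosine_mat f \<tau> \<sigma> n =
     (1/4) \<cdot>\<^sub>m hankel_mat f \<tau> \<sigma> n + (1/4) \<cdot>\<^sub>m hankel_mat f \<tau> (- \<sigma>) n +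
     (1/4) \<cdot>\<^sub>m toeplitz_mat f \<tau> \<sigma> n + (1/4) \<cdot>\<^sub>m toeplitz_mat f \<tau> (- \<sigma>) n"

text \<open>
  The parameters \<open>\<phi>\<close> and \<open>\<alpha>\<close> are indexed by \<open>1, \<dots>, n\<close>, whereas matrix
  positions count from \<open>0\<close>; hence the index shift by \<open>Suc\<close> below.
\<close>

definition W_mat :: "(nat \<Rightarrow> real) \<Rightarrow> real \<Rightarrow> nat \<Rightarrow> nat \<Rightarrow> complex mat" where
  "W_mat \<phi> \<Delta> \<sigma> n =
     mat n n (\<lambda>(k, j). complex_of_real (cos (\<phi> (Suc j) * real k * real \<sigma> * \<Delta>)))"

definition L_mat :: "(nat \<Rightarrow> real) \<Rightarrow> real \<Rightarrow> int \<Rightarrow> nat \<Rightarrow> complex mat" where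
  "L_mat \<phi> \<Delta> \<tau> n =
     mat_diag n (\<lambda>j. complex_of_real (cos (\<phi> (Suc j) * real_of_int \<tau> * \<Delta>)))"

definition A_mat :: "(nat \<Rightarrow> complex) \<Rightarrow> nat \<Rightarrow> complex mat" where
  "A_mat \<alpha> n = mat_diag n (\<lambda>j. \<alpha> (Suc j))"

end

theory Submission
  imports Defs
begin

text \<open>
  Entrywise, the factorization is the product-to-sum formula for three cosines, summed over
  the frequencies with weights \<open>\<alpha>\<close>: the four sign choices on its left-hand side are
  the two Hankel and the two Toeplitz contributions.
\<close>

lemma cos_add_four:
  fixes t a b :: real
  shows "cos (t + (a + b)) + cos (t - (a + b)) + cos (t + (a - b)) + cos (t - (a - b)) =
    4 * (cos a * cos t * cos b)"
  \<comment> \<open>The sine products cancel within each pair \<open>t + x\<close>,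
    \<open>t - x\<close>, leaving \<open>2 * cos t * cos x\<close>. The cases
    \<open>x = a + b\<close> and \<open>x = a - b\<close> then combine in the same way.\<close>
  by (simp add: cos_add cos_diff sin_add sin_diff algebra_simps)

theorem theorem1:
  fixes n \<sigma> :: nat and \<tau> :: int and \<Delta> :: real
    and \<alpha> :: "nat \<Rightarrow> complex" and \<phi> :: "nat \<Rightarrow> real" and f :: "int \<Rightarrow> complex"
  assumes "n > 0" and "\<sigma> > 0" and "\<Delta> > 0"
    and "\<And>i. i \<in> {1..n} \<Longrightarrow> \<bar>\<phi> i\<bar> * \<Delta> < pi"
    and "\<And>s. f s = (\<Sum>i=1..n. \<alpha> i * complex_of_real (cos (\<phi> i * real_of_int s * \<Delta>)))"
  shows "cosine_mat f \<tau> (int \<sigma>) n =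
    W_mat \<phi> \<Delta> \<sigma> n * L_mat \<phi> \<Delta> \<tau> n * A_mat \<alpha> n * transpose_mat (W_mat \<phi> \<Delta> \<sigma> n)"
    (is "?C = ?P")
proof (rule eq_matI)
  \<comment> \<open>These abbreviations stay real-valued and are indexed by frequency from 1, so
    that \<open>cos_add_four\<close> applies before embedding into the complex numbers.\<close>
  define w where "w k i = cos (\<phi> i * real k * real \<sigma> * \<Delta>)" for k i
  define c where "c i = cos (\<phi> i * real_of_int \<tau> * \<Delta>)" for i
  define g where "g i s = cos (\<phi> i * real_of_int s * \<Delta>)" for i s
  have W: "W_mat \<phi> \<Delta> \<sigma> n = mat n n (\<lambda>(k, j). complex_of_real (w k (Suc j)))"
    by (simp add: W_mat_def w_def)
  \<comment> \<open>Right multiplication by a diagonal matrix scales columns, so only the product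
    with the transpose needs a genuine sum.\<close>
  have WL: "W_mat \<phi> \<Delta> \<sigma> n * L_mat \<phi> \<Delta> \<tau> n * A_mat \<alpha> n =
    mat n n (\<lambda>(k, j). complex_of_real (w k (Suc j) * c (Suc j)) * \<alpha> (Suc j))"
    unfolding W L_mat_def A_mat_def
    by (auto simp: mat_diag_mult_right[of _ n n] c_def)
  fix k l
  assume "k < dim_row ?P" and "l < dim_col ?P"
  then have k: "k < n" and l: "l < n"
    by (simp_all add: W_mat_def)
  \<comment> \<open>Here \<open>t\<close> carries the shift \<tau>, while \<open>a\<close> and
    \<open>b\<close> carry the row and column index; negating the step \<sigma> turns
    \<open>t + x\<close> into \<open>t - x\<close>.\<close>
  have four: "g i (\<tau> + (int k + int l) * int \<sigma>) + g i (\<tau> + (int k + int l) * - int \<sigma>)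
      + g i (\<tau> + (int k - int l) * int \<sigma>) + g i (\<tau> + (int k - int l) * - int \<sigma>)
      = 4 * (w k i * c i * w l i)" for i
    using cos_add_four[of "\<phi> i * real_of_int \<tau> * \<Delta>" "\<phi> i * real k * real \<sigma> * \<Delta>"
        "\<phi> i * real l * real \<sigma> * \<Delta>"]
    by (simp add: g_def w_def c_def algebra_simps)
  have "?C $$ (k, l) = (1/4) * (f (\<tau> + (int k + int l) * int \<sigma>)
      + f (\<tau> + (int k + int l) * - int \<sigma>)
      + f (\<tau> + (int k - int l) * int \<sigma>) + f (\<tau> + (int k - int l) * - int \<sigma>))"
    using k l by (simp add: cosine_mat_def hankel_mat_def toeplitz_mat_def)
  also have "\<dots> = (1/4) * (\<Sum>i=1..n. \<alpha> i * complex_of_real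
      (g i (\<tau> + (int k + int l) * int \<sigma>) + g i (\<tau> + (int k + int l) * - int \<sigma>)
      + g i (\<tau> + (int k - int l) * int \<sigma>) + g i (\<tau> + (int k - int l) * - int \<sigma>)))"
    unfolding assms(5) g_def[symmetric] by (simp only: sum.distrib of_real_add distrib_left)
  also have "\<dots> = (\<Sum>i=1..n. \<alpha> i * complex_of_real (w k i * c i * w l i))"
    unfolding four by (simp add: sum_distrib_left mult.assoc)
  \<comment> \<open>Frequencies count from 1 but matrix columns from 0, hence
    \<open>i = Suc j\<close>.\<close>
  also have "\<dots> = (\<Sum>j<n. \<alpha> (Suc j) * complex_of_real (w k (Suc j) * c (Suc j) * w l (Suc j)))"
    by (simp add: sum.atLeast1_atMost_eq)
  also have "\<dots> = ?P $$ (k, l)"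
    \<comment> \<open>The order matters: rewriting with \<open>W\<close> first would destroy the
      left-hand side of \<open>WL\<close>.\<close>
    unfolding WL unfolding W using k l
    by (simp add: scalar_prod_def lessThan_atLeast0 mult_ac)
  finally show "?C $$ (k, l) = ?P $$ (k, l)" .
qed (simp_all add: cosine_mat_def hankel_mat_def toeplitz_mat_def W_mat_def)

end
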